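(* Let $n\ge 1$ and let $A=(a_{ij})_{1\le i,j\le n}$ be a complex symmetric matrix (that is, $A^T=A$) with $\det(A)\neq 0$, such that Gauss elimination without pivoting can be carried out on $A$ (that is, $a_{kk}^{(k-1)}\neq 0$ for $k=1,\dots,n-1$). Let $$U(A)=\begin{pmatrix} u_{11} & u_{12} & \cdots & u_{1n}\\ 0 & u_{22} & \cdots & u_{2n}\\ \vdots & \vdots & \ddots & \vdots\\ 0 & 0 & \cdots & u_{nn}\end{pmatrix}$$ be the Gauss matrix of $A$. For each $i$ let $\sqrt{u_{ii}}$ denote a square root of the complex number $u_{ii}$. Then $A=G^TG$, where $G$ is the upper triangular matrix $$G=\begin{pmatrix} \frac{u_{11}}{\sqrt{u_{11}}} & \frac{u_{12}}{\sqrt{u_{11}}} & \cdots & \frac{u_{1n}}{\sqrt{u_{11}}}\\ 0 & \frac{u_{22}}{\sqrt{u_{22}}} & \cdots & \frac{u_{2n}}{\sqrt{u_{22}}}\\ \vdots & \vdots & \ddots & \vdots\\ 0 & 0 & \cdots & \frac{u_{nn}}{\sqrt{u_{nn}}}\end{pmatrix},$$ i.e. $G_{ij}=u_{ij}/\sqrt{u_{ii}}$ for $i\le j$ and $G_{ij}=0$ for $i>j$.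
   Context: $G^T$ denotes the transpose of $G$ (without complex conjugation). Gauss elimination without pivoting: set $A_0=A$, with entries $a_{ij}^{(0)}=a_{ij}$. For $k=1,\dots,n-1$, provided the pivot $a_{kk}^{(k-1)}$ (the $(k,k)$ entry of $A_{k-1}$) is nonzero, let $G_k$ be the lower triangular $n\times n$ matrix with ones on the diagonal, entries $-a_{ik}^{(k-1)}/a_{kk}^{(k-1)}$ in position $(i,k)$ for $i=k+1,\dots,n$, and zeros elsewhere, and put $A_k=G_kA_{k-1}$. Thus for $i>k$ the $(i,j)$ entry of $A_k$ is $$a_{ij}^{(k)}=a_{ij}^{(k-1)}-\frac{a_{ik}^{(k-1)}a_{kj}^{(k-1)}}{a_{kk}^{(k-1)}},$$ and the rows $1,\dots,k$ of $A_k$ are those of $A_{k-1}$. The Gauss matrix of $A$ is the resulting upper triangular matrix $U(A)=A_{n-1}=G_{n-1}\cdots G_2G_1A$ (with $U(A)=A$ if $n=1$). Its entries are $u_{ij}=a_{ij}^{(i-1)}$ for $i\le j$ and $u_{ij}=0$ for $i>j$. *)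

theory Defs
  imports Complex_Main "Jordan_Normal_Form.Determinant"
begin

text \<open>Matrix indices start at 0. Thus \<open>gauss_iterate A k\<close> is $A_k = G_k \cdots G_1 A$, the matrix
  after \<open>k\<close> elimination steps; its entry at \<open>(k, k)\<close> is the pivot of the next step, and
  \<open>gauss_factor k A\<^sub>k\<close> is $G_{k+1}$. No pivoting takes place.\<close>

definition gauss_factor :: "nat \<Rightarrow> 'a::field mat \<Rightarrow> 'a mat" where
  "gauss_factor k B = mat (dim_row B) (dim_row B)
     (\<lambda>(i, j). if i = j then 1
               else if j = k \<and> k < i then - (B $$ (i, k) / B $$ (k, k))
               else 0)"

primrec gauss_iterate :: "'a::field mat \<Rightarrow> nat \<Rightarrow> 'a mat" where
  "gauss_iterate A 0 = A"
| "gauss_iterate A (Suc k) = gauss_factor k (gauss_iterate A k) * gauss_iterate A k"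

text \<open>There are $n - 1$ elimination steps, so the last diagonal entry is not required
  to be nonzero.\<close>

definition gauss_admissible :: "'a::field mat \<Rightarrow> bool" where
  "gauss_admissible A \<longleftrightarrow>
     (\<forall>k. Suc k < dim_row A \<longrightarrow> gauss_iterate A k $$ (k, k) \<noteq> 0)"

definition gauss_matrix :: "'a::field mat \<Rightarrow> 'a mat" where
  "gauss_matrix A = gauss_iterate A (dim_row A - 1)"

end

theory Submission
  imports Defs
begin

text \<open>Write $a^{(k)}_{ij}$ for the entries of $A_k$, with indices from 0. As $A$ is symmetric, so
  is the block $i, j \ge k$ of every $A_k$, since each elimination step subtracts a multiple of
  $a^{(k)}_{ik} a^{(k)}_{kj} = a^{(k)}_{ki} a^{(k)}_{kj}$ from it. Adding up these subtractions
  gives, for $i, j \ge k$,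
  \[ a^{(k)}_{ij} = a_{ij} - \sum_{m<k} \frac{u_{mi} u_{mj}}{u_{mm}}, \]
  because row $m$ is final after $m$ steps, i.e. $a^{(m)}_{mj} = u_{mj}$
  (lemma \<open>gauss_iterate_symmetric_entry\<close>). For $k = i \le j$ the left-hand side is
  $u_{ij} = u_{ii} u_{ij} / u_{ii}$, so that $a_{ij} = \sum_{m \le i} u_{mi} u_{mj} / u_{mm}$,
  which is the $(i,j)$ entry of $G^T G$. The case $j < i$ follows since both matrices are
  symmetric.\<close>

lemma gauss_iterate_carrier:
  assumes "A \<in> carrier_mat n n"
  shows "gauss_iterate A k \<in> carrier_mat n n"
  using assms by (induction k) (auto simp: gauss_factor_def)

lemma gauss_iterate_Suc_entry:
  assumes A: "A \<in> carrier_mat n n" and "i < n" "j < n" "k < n"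
  defines "B \<equiv> gauss_iterate A k"
  shows "gauss_iterate A (Suc k) $$ (i, j) =
    (if i \<le> k then B $$ (i, j) else B $$ (i, j) - B $$ (i, k) * B $$ (k, j) / B $$ (k, k))"
proof -
  have B: "B \<in> carrier_mat n n"
    unfolding B_def by (rule gauss_iterate_carrier[OF A])
  have "gauss_iterate A (Suc k) $$ (i, j) = (\<Sum>l<n. gauss_factor k B $$ (i, l) * B $$ (l, j))"
    using assms(2-4) B
    by (simp add: B_def[symmetric] gauss_factor_def scalar_prod_def lessThan_atLeast0)
  also have "\<dots> = (\<Sum>l<n. (if l = i then B $$ (l, j) else 0) +
      (if l = k then if k < i then - (B $$ (i, k) / B $$ (k, k)) * B $$ (l, j) else 0 else 0))"
    using assms(2-4) B by (intro sum.cong) (auto simp: gauss_factor_def)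
  also have "\<dots> = B $$ (i, j) + (if k < i then - (B $$ (i, k) / B $$ (k, k)) * B $$ (k, j) else 0)"
    using assms(2-4) by (simp add: sum.distrib)
  finally show ?thesis
    by simp
qed

lemma gauss_iterate_row_final:
  assumes "A \<in> carrier_mat n n" "i < n" "j < n" "i \<le> k" "k \<le> n"
  shows "gauss_iterate A k $$ (i, j) = gauss_iterate A i $$ (i, j)"
  using assms(4,5)
proof (induction k rule: dec_induct)
  case base
  then show ?case by simp
next
  case (step k)
  then show ?case
    using gauss_iterate_Suc_entry[OF assms(1-3), of k] by simp
qed

lemma gauss_matrix_entry:
  assumes "A \<in> carrier_mat n n" "i < n" "j < n"
  shows "gauss_matrix A $$ (i, j) = gauss_iterate A i $$ (i, j)"
  using assms gauss_iterate_row_final[OF assms, of "n - 1"] by (simp add: gauss_matrix_def)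

lemma gauss_iterate_symmetric_block:
  assumes A: "A \<in> carrier_mat n n" and sym: "transpose_mat A = A"
    and "k \<le> i" "i < n" "k \<le> j" "j < n"
  shows "gauss_iterate A k $$ (i, j) = gauss_iterate A k $$ (j, i)"
  using assms(3-)
proof (induction k arbitrary: i j)
  case 0
  then have "A $$ (i, j) = transpose_mat A $$ (i, j)"
    using sym by simp
  with 0 A show ?case by simp
next
  case (Suc k)
  then show ?case
    using Suc.IH[of i j] Suc.IH[of i k] Suc.IH[of j k]
    by (simp add: gauss_iterate_Suc_entry[OF A] del: gauss_iterate.simps)
qed

lemma gauss_iterate_symmetric_entry:
  assumes A: "A \<in> carrier_mat n n" and sym: "transpose_mat A = A"
    and "k \<le> i" "i < n" "k \<le> j" "j < n"
  defines "U \<equiv> gauss_matrix A"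
  shows "gauss_iterate A k $$ (i, j) =
    A $$ (i, j) - (\<Sum>m<k. U $$ (m, i) * U $$ (m, j) / U $$ (m, m))"
  using assms(3-6)
proof (induction k)
  case 0
  then show ?case by simp
next
  case (Suc k)
  then show ?case
    using gauss_iterate_symmetric_block[OF A sym, of k i k]
    by (simp add: gauss_iterate_Suc_entry[OF A] U_def gauss_matrix_entry[OF A]
        del: gauss_iterate.simps(2))
qed

text \<open>The factorization \<open>A = U\<^sup>T D\<^sup>-\<^sup>1 U\<close> with \<open>D\<close> the diagonal of \<open>U\<close>, entry by entry on and above
  the diagonal. Division by zero yields zero, so a vanishing last pivot does no harm.\<close>

lemma gauss_matrix_symmetric_factorization:
  assumes A: "A \<in> carrier_mat n n" and sym: "transpose_mat A = A"
    and adm: "gauss_admissible A" and "i \<le> j" "j < n"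
  defines "U \<equiv> gauss_matrix A"
  shows "A $$ (i, j) = (\<Sum>m\<le>i. U $$ (m, i) * U $$ (m, j) / U $$ (m, m))"
proof -
  have "U $$ (i, j) = A $$ (i, j) - (\<Sum>m<i. U $$ (m, i) * U $$ (m, j) / U $$ (m, m))"
    using gauss_iterate_symmetric_entry[OF A sym, of i i j] gauss_matrix_entry[OF A, of i j]
      assms(4,5) by (simp add: U_def)
  moreover have "U $$ (i, i) * U $$ (i, j) / U $$ (i, i) = U $$ (i, j)"
  proof (cases "i = j")
    case True
    then show ?thesis by simp
  next
    case False
    \<comment> \<open>Now \<open>i\<close> is not the last index, so \<open>U $$ (i, i)\<close> is one of the pivots.\<close>
    then have "U $$ (i, i) \<noteq> 0"
      using adm A assms(4,5) by (simp add: gauss_admissible_def U_def gauss_matrix_entry[OF A])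
    then show ?thesis by simp
  qed
  ultimately show ?thesis
    by (simp add: lessThan_Suc_atMost[symmetric])
qed

theorem proposition2:
  fixes A U G :: "complex mat" and n :: nat and s :: "nat \<Rightarrow> complex"
  assumes "n \<ge> 1"
    and "A \<in> carrier_mat n n"
    and "transpose_mat A = A"
    and "det A \<noteq> 0"
    and "gauss_admissible A"
    and "U = gauss_matrix A"
    and "\<And>i. i < n \<Longrightarrow> (s i)\<^sup>2 = U $$ (i, i)"
    and "G = mat n n (\<lambda>(i, j). if i \<le> j then U $$ (i, j) / s i else 0)"
  shows "A = transpose_mat G * G"
proof -
  note A = assms(2) and sym = assms(3)
  have entry: "(transpose_mat G * G) $$ (i, j) = (\<Sum>m<n. G $$ (m, i) * G $$ (m, j))"
    if "i < n" "j < n" for i j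
    using that by (simp add: assms(8) scalar_prod_def lessThan_atLeast0)
  have upper: "A $$ (i, j) = (\<Sum>m<n. G $$ (m, i) * G $$ (m, j))" if "i \<le> j" "j < n" for i j
  proof -
    have "A $$ (i, j) = (\<Sum>m\<le>i. U $$ (m, i) * U $$ (m, j) / U $$ (m, m))"
      using gauss_matrix_symmetric_factorization[OF A sym assms(5) that] by (simp add: assms(6))
    also have "\<dots> = (\<Sum>m\<le>i. G $$ (m, i) * G $$ (m, j))"
      using that
      by (intro sum.cong) (auto simp: assms(8) assms(7)[symmetric] power2_eq_square)
    also have "\<dots> = (\<Sum>m<n. G $$ (m, i) * G $$ (m, j))"
      using that by (intro sum.mono_neutral_left) (auto simp: assms(8))
    finally show ?thesis .
  qed
  show ?thesis
  proof (rule eq_matI)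
    fix i j
    assume "i < dim_row (transpose_mat G * G)" "j < dim_col (transpose_mat G * G)"
    then have ij: "i < n" "j < n"
      by (simp_all add: assms(8))
    show "A $$ (i, j) = (transpose_mat G * G) $$ (i, j)"
    proof (cases "i \<le> j")
      case True
      then show ?thesis
        using ij upper entry by simp
    next
      case False
      have "A $$ (i, j) = A $$ (j, i)"
        using gauss_iterate_symmetric_block[OF A sym, of 0 i j] ij by simp
      then show ?thesis
        using False ij upper[of j i] entry by (simp add: mult.commute)
    qed
  qed (use A in \<open>simp_all add: assms(8)\<close>)
qed

end
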